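(* Let $\mathcal{G}=(\mathcal{V},\mathcal{E})$ be a simple connected graph of order $n$, let $1\le r<n$, and let $\mathcal{E}_{cs}\subseteq\mathcal{E}$ be a set of edges with $|\mathcal{E}_{cs}|=n-r$. If the contraction $\mathcal{G}/\!/\mathcal{E}_{cs}$ is edge-matching and node-removal equivalent, then $L(\mathcal{G}/\!/\mathcal{E}_{cs})$ interlaces $L(\mathcal{G})$, where $L$ denotes the graph Laplacian matrix.
   Context: Graphs are finite and undirected. The Laplacian $L(\mathcal{G})$ has $[L(\mathcal{G})]_{uu}=d_u(\mathcal{G})$ (the degree of $u$), $[L(\mathcal{G})]_{uv}=-1$ if $u\sim v$, and $0$ otherwise. Contraction: for a partition $\pi$ of $\mathcal{V}$ into nonempty cells $C_1(\pi),\dots,C_p(\pi)$, the contraction $\mathcal{G}/\!/\pi$ is the simple graph with vertex set $\{1,\dots,p\}$ in which $i\ne j$ are adjacent iff some edge of $\mathcal{G}$ joins a vertex of $C_i(\pi)$ to a vertex of $C_j(\pi)$. For $\mathcal{E}_{cs}\subseteq\mathcal{E}$, let $\pi_c(\mathcal{G},\mathcal{E}_{cs})$ be the partition of $\mathcal{V}$ into the vertex sets of the connected components of the graph $(\mathcal{V},\mathcal{E}_{cs})$, and $\mathcal{G}/\!/\mathcal{E}_{cs}:=\mathcal{G}/\!/\pi_c(\mathcal{G},\mathcal{E}_{cs})$. $\mathcal{G}/\!/\mathcal{E}_{cs}$ is edge-matching if there is a one-to-one correspondence between $\mathcal{E}\setminus\mathcal{E}_{cs}$ and the edge set of $\mathcal{G}/\!/\mathcal{E}_{cs}$;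 equivalently $|\mathcal{E}\setminus\mathcal{E}_{cs}|=|\mathcal{E}(\mathcal{G}/\!/\mathcal{E}_{cs})|$. $\mathcal{G}/\!/\pi$ is node-removal equivalent if there is a subset $\mathcal{V}_S\subset\mathcal{V}$ such that $\mathcal{G}/\!/\pi=\mathcal{G}\setminus\mathcal{V}_S$ up to relabeling of vertices (graph isomorphism), where $\mathcal{G}\setminus\mathcal{V}_S$ is obtained by deleting all vertices of $\mathcal{V}_S$ and their incident edges. Interlacing: a real symmetric matrix $B\in\mathbb{R}^{p\times p}$ interlaces a real symmetric matrix $A\in\mathbb{R}^{n\times n}$, $0<p<n$, if $\lambda_k(A)\le\lambda_k(B)\le\lambda_{n-p+k}(A)$ for $k=1,\dots,p$, eigenvalues being in ascending order. Here $p$ is the order of $\mathcal{G}/\!/\mathcal{E}_{cs}$. *)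

theory Defs
  imports "Jordan_Normal_Form.Char_Poly"
begin

record 'a ugraph =
  verts :: "'a set"
  edges :: "'a set set"

definition simple_graph :: "'a ugraph \<Rightarrow> bool" where
  "simple_graph G \<longleftrightarrow> finite (verts G) \<and> (\<forall>e\<in>edges G. e \<subseteq> verts G \<and> card e = 2)"

definition adjacent :: "'a ugraph \<Rightarrow> 'a \<Rightarrow> 'a \<Rightarrow> bool" where
  "adjacent G u v \<longleftrightarrow> {u, v} \<in> edges G"

definition reachability :: "'a ugraph \<Rightarrow> ('a \<times> 'a) set" where
  "reachability G = {(u, v) \<in> verts G \<times> verts G. (adjacent G)\<^sup>*\<^sup>* u v}"

definition connected_graph :: "'a ugraph \<Rightarrow> bool" where
  "connected_graph G \<longleftrightarrow> verts G \<noteq> {} \<and> (\<forall>u\<in>verts G. \<forall>v\<in>verts G. (u, v) \<in> reachability G)"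

definition conn_components :: "'a ugraph \<Rightarrow> 'a set set" where
  "conn_components G = verts G // reachability G"

definition contraction_partition :: "'a ugraph \<Rightarrow> 'a set set \<Rightarrow> 'a set set" where
  "contraction_partition G F = conn_components \<lparr>verts = verts G, edges = F\<rparr>"

(* The cells of the partition are C 1, ..., C p. *)
definition contract :: "'a ugraph \<Rightarrow> nat \<Rightarrow> (nat \<Rightarrow> 'a set) \<Rightarrow> nat ugraph" where
  "contract G p C =
     \<lparr>verts = {1..p},
      edges = {{i, j} | i j. i \<in> {1..p} \<and> j \<in> {1..p} \<and> i \<noteq> j \<and>
                 (\<exists>u\<in>C i. \<exists>v\<in>C j. adjacent G u v)}\<rparr>"

definition edge_matching :: "'a ugraph \<Rightarrow> 'a set set \<Rightarrow> 'b ugraph \<Rightarrow> bool" where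
  "edge_matching G F H \<longleftrightarrow> (\<exists>f. bij_betw f (edges G - F) (edges H))"

definition graph_isomorphic :: "'a ugraph \<Rightarrow> 'b ugraph \<Rightarrow> bool" where
  "graph_isomorphic G H \<longleftrightarrow>
     (\<exists>f. bij_betw f (verts G) (verts H) \<and>
          (\<forall>u\<in>verts G. \<forall>v\<in>verts G. adjacent G u v \<longleftrightarrow> adjacent H (f u) (f v)))"

definition delete_verts :: "'a ugraph \<Rightarrow> 'a set \<Rightarrow> 'a ugraph" where
  "delete_verts G S = \<lparr>verts = verts G - S, edges = {e \<in> edges G. e \<inter> S = {}}\<rparr>"

definition node_removal_equivalent :: "'a ugraph \<Rightarrow> 'b ugraph \<Rightarrow> bool" where
  "node_removal_equivalent G H \<longleftrightarrow>
     (\<exists>S. S \<subset> verts G \<and> graph_isomorphic H (delete_verts G S))"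

definition vertex_degree :: "'a ugraph \<Rightarrow> 'a \<Rightarrow> nat" where
  "vertex_degree G u = card {v \<in> verts G. adjacent G u v}"

(* Row and column i belong to the vertex \<nu> i, where \<nu> numbers the vertices from 0. *)
definition laplacian :: "(nat \<Rightarrow> 'a) \<Rightarrow> 'a ugraph \<Rightarrow> real mat" where
  "laplacian \<nu> G = mat (card (verts G)) (card (verts G)) (\<lambda>(i, j).
     if i = j then real (vertex_degree G (\<nu> i))
     else if adjacent G (\<nu> i) (\<nu> j) then - 1 else 0)"

(* The k-th smallest eigenvalue (k = 1, 2, ...), counted with multiplicity. It is meaningful
   only if the characteristic polynomial splits over the reals, as for symmetric matrices. *)
definition eigval :: "nat \<Rightarrow> real mat \<Rightarrow> real" where
  "eigval k A = sorted_list_of_multiset (proots (char_poly A)) ! (k - 1)"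

definition real_symmetric :: "nat \<Rightarrow> real mat \<Rightarrow> bool" where
  "real_symmetric n A \<longleftrightarrow> A \<in> carrier_mat n n \<and> transpose_mat A = A"

definition interlaces :: "real mat \<Rightarrow> real mat \<Rightarrow> bool" where
  "interlaces B A \<longleftrightarrow>
     (\<exists>n p. real_symmetric n A \<and> real_symmetric p B \<and> 0 < p \<and> p < n \<and>
        (\<forall>k\<in>{1..p}. eigval k A \<le> eigval k B \<and> eigval k B \<le> eigval (n - p + k) A))"

end

theory Submission
  imports Defs "Jordan_Normal_Form.Schur_Decomposition"
begin

text \<open>
  The Laplacian of a graph represents the Dirichlet energy: for a function \<open>f\<close> on the vertices,
  the quadratic form is the sum of \<open>(f u - f v)\<^sup>2\<close> over the edges. Both halves of the interlacing
  are comparisons of energies, turned into comparisons of eigenvalues by the Courant-Fischer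
  dimension count.

  For \<open>\<lambda>\<^sub>k(G) \<le> \<lambda>\<^sub>k(G // E)\<close>, pull a function \<open>g\<close> on the cells back to the vertices of \<open>G\<close>, making it
  constant on every cell. Every edge of the contraction comes from an edge of \<open>G\<close> outside the
  contracted set, so equality of the two numbers of edges forces this correspondence to be
  one-to-one: no two edges of \<open>G\<close> between distinct cells are merged. Hence the pullback has at most
  the energy of \<open>g\<close> (\<open>contraction_energy_le\<close>), while its norm is at least that of \<open>g\<close>, since no cell
  is empty. As the energy is nonnegative, a larger norm only lowers the Rayleigh quotient
  (\<open>eigval_le_of_energy_decrease\<close>).

  For \<open>\<lambda>\<^sub>k(G // E) \<le> \<lambda>\<^bsub>n-p+k\<^esub>(G)\<close>, identify the contraction with an induced subgraph of \<open>G\<close> and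
  extend a function by zero to the deleted vertices. This preserves the norm and can only add the
  energy of the deleted edges (\<open>node_removal_eigval_le\<close>).

  The dimension count needs orthonormal eigenbases ordered like the roots of the characteristic
  polynomial (\<open>symmetric_eigenbasis\<close>). Given a linear map \<open>T\<close> from \<open>p\<close>-space to \<open>n\<close>-space, a span of
  eigenvectors in the domain and one in the codomain whose dimensions add up to more than \<open>n\<close>
  admit a nonzero \<open>y\<close> in the first with \<open>T y\<close> in the second (\<open>common_vector_by_dimension\<close>), and the two
  Rayleigh quotients are bounded by eigenvalues there.
\<close>

section \<open>Orthonormal eigenbases of real symmetric matrices\<close>

text \<open>
  Moving the symmetric matrix across the Hermitian product turns the eigenvalue \<open>a\<close> of \<open>v\<close> into its
  conjugate, while the product of \<open>v\<close> with itself is nonzero.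
\<close>
lemma complex_eigenvalue_of_real_symmetric_is_real:
  assumes A: "real_symmetric n A"
    and ev: "eigenvalue (map_mat complex_of_real A) a"
  shows "a \<in> \<real>"
proof -
  define M where "M = map_mat complex_of_real A"
  from A have Ac: "A \<in> carrier_mat n n" and At: "transpose_mat A = A"
    by (auto simp: real_symmetric_def)
  have M: "M \<in> carrier_mat n n" using Ac by (auto simp: M_def)
  have Mt: "transpose_mat M = M" using At by (metis M_def map_mat_transpose)
  from ev obtain v where v: "v \<in> carrier_vec n" and v0: "v \<noteq> 0\<^sub>v n"
    and Mv: "M *\<^sub>v v = a \<cdot>\<^sub>v v"
    using M by (auto simp: eigenvalue_def eigenvector_def M_def[symmetric])
  have conj_Mv: "conjugate (M *\<^sub>v v) = M *\<^sub>v conjugate v"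
  proof (rule eq_vecI)
    fix i assume "i < dim_vec (M *\<^sub>v conjugate v)"
    then have i: "i < n" using M by simp
    have row: "conjugate (row M i) = row M i"
      using i Ac by (intro eq_vecI) (auto simp: M_def)
    have "conjugate (row M i \<bullet> v) = conjugate (row M i) \<bullet> conjugate v"
      using M v i by (intro conjugate_sprod_vec[of _ n]) auto
    then show "conjugate (M *\<^sub>v v) $ i = (M *\<^sub>v conjugate v) $ i"
      using i M by (simp add: row)
  qed (use M in auto)
  have "a * (v \<bullet>c v) = (M *\<^sub>v v) \<bullet>c v"
    using v by (simp add: Mv)
  also have "\<dots> = v \<bullet> (M *\<^sub>v conjugate v)"
    using transpose_vec_mult_scalar[OF M, of "conjugate v" v] v Mt by simp
  also have "\<dots> = v \<bullet>c (a \<cdot>\<^sub>v v)" by (simp flip: conj_Mv add: Mv)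
  also have "\<dots> = cnj a * (v \<bullet>c v)" using v by (simp add: conjugate_smult_vec)
  finally have "a = cnj a" using v v0 by simp
  then show ?thesis by (simp add: Reals_cnj_iff)
qed

text \<open>
  Over the complex numbers every polynomial splits, and all the roots are real here.
\<close>
lemma char_poly_real_symmetric_splits:
  assumes A: "real_symmetric n A"
  obtains es :: "real list" where "char_poly A = (\<Prod>e\<leftarrow>es. [:- e, 1:])"
proof -
  define M where "M = map_mat complex_of_real A"
  interpret poly: map_poly_inj_idom_hom complex_of_real ..
  have Ac: "A \<in> carrier_mat n n" using A by (simp add: real_symmetric_def)
  then have M: "M \<in> carrier_mat n n" by (simp add: M_def)
  obtain as where as: "char_poly M = (\<Prod>a\<leftarrow>as. [:- a, 1:])"
    using char_poly_factorized[OF M] by blast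
  have real: "complex_of_real (Re a) = a" if "a \<in> set as" for a
  proof -
    have "poly (char_poly M) a = 0"
      using that unfolding as by (auto simp: poly_prod_list prod_list_zero_iff image_iff)
    then have "eigenvalue M a" using eigenvalue_root_char_poly[OF M] by simp
    then show ?thesis
      using complex_eigenvalue_of_real_symmetric_is_real[OF A] by (simp add: M_def)
  qed
  have "map_poly complex_of_real (char_poly A) = (\<Prod>a\<leftarrow>as. [:- a, 1:])"
    unfolding as[symmetric] M_def by (rule of_real_hom.char_poly_hom[OF Ac, symmetric])
  also have "\<dots> = (\<Prod>a\<leftarrow>as. map_poly complex_of_real [:- Re a, 1:])"
    by (intro arg_cong[where f = prod_list] map_cong) (auto simp: real)
  also have "\<dots> = map_poly complex_of_real (\<Prod>e\<leftarrow>map Re as. [:- e, 1:])"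
    by (simp add: poly.hom_prod_list comp_def)
  finally show thesis using that poly.injectivity by blast
qed

text \<open>
  Gram-Schmidt applied to any basis that starts with \<open>v\<close> leaves \<open>v\<close> in front; it remains to
  normalize the columns.
\<close>
lemma orthonormal_completion:
  fixes v :: "real vec"
  assumes v: "v \<in> carrier_vec n" and v0: "v \<noteq> 0\<^sub>v n"
  obtains W c where "W \<in> carrier_mat n n" "transpose_mat W * W = 1\<^sub>m n" "col W 0 = c \<cdot>\<^sub>v v"
proof -
  interpret cof_vec_space n "TYPE(real)" .
  define b where "b = basis_completion v"
  define ws where "ws = gram_schmidt n b"
  note basis = basis_completion[OF v v0, folded b_def]
  have n0: "n \<noteq> 0" using v v0 by auto
  then obtain vs where bv: "b = v # vs" using basis(6,7) by (cases b) auto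
  note gs = gram_schmidt_result[OF basis(2) basis(4) basis(5) refl, folded ws_def]
  have len: "length ws = n" using gs(4) basis(6) by simp
  have hd: "ws ! 0 = v"
    using gram_schmidt_hd[OF v, of vs, folded bv] len n0 by (cases ws) (auto simp: ws_def)
  have wsc: "ws ! i \<in> carrier_vec n" if "i < n" for i
    using gs(3) len that by auto
  have orth: "(ws ! i \<bullet> ws ! j = 0) = (i \<noteq> j)" if "i < n" "j < n" for i j
    using corthogonalD[OF gs(2), of i j] len that by simp
  have pos: "ws ! i \<bullet> ws ! i > 0" if "i < n" for i
    using conjugate_square_ge_0_vec[of "ws ! i"] orth[OF that that] by simp
  define s where "s i = 1 / sqrt (ws ! i \<bullet> ws ! i)" for i
  define W where "W = mat n n (\<lambda>(i, j). s j * ws ! j $ i)"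
  have col: "col W j = s j \<cdot>\<^sub>v ws ! j" if "j < n" for j
    using that wsc[OF that] by (intro eq_vecI) (auto simp: W_def)
  have W: "W \<in> carrier_mat n n" by (simp add: W_def)
  have "transpose_mat W * W = 1\<^sub>m n"
  proof (rule eq_matI)
    fix i j assume "i < dim_row (1\<^sub>m n)" "j < dim_col (1\<^sub>m n)"
    then have ij: "i < n" "j < n" by auto
    have "(transpose_mat W * W) $$ (i, j) = (s i \<cdot>\<^sub>v ws ! i) \<bullet> (s j \<cdot>\<^sub>v ws ! j)"
      using ij W by (simp add: col)
    also have "\<dots> = s i * s j * (ws ! i \<bullet> ws ! j)"
      using wsc[OF ij(1)] wsc[OF ij(2)] by simp
    also have "\<dots> = 1\<^sub>m n $$ (i, j)"
      using orth[OF ij] pos[OF ij(1)] ij by (auto simp: s_def)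
    finally show "(transpose_mat W * W) $$ (i, j) = 1\<^sub>m n $$ (i, j)" .
  qed (use W in auto)
  moreover have "col W 0 = s 0 \<cdot>\<^sub>v v" using col[of 0] n0 hd by simp
  ultimately show thesis using that W by blast
qed

text \<open>
  Conjugating by an orthogonal matrix whose first column is an eigenvector for \<open>e\<close> clears the first
  column except for its corner, hence by symmetry also the first row; the induction continues on
  the remaining block. The order of the list is the order in which the eigenvalues are split off,
  so that any enumeration of the roots can be prescribed on the diagonal.
\<close>
lemma orthogonal_diagonalization:
  fixes A :: "real mat"
  assumes "A \<in> carrier_mat n n" "transpose_mat A = A"
    and "char_poly A = (\<Prod>e\<leftarrow>es. [:- e, 1:])"
  shows "length es = n \<and> (\<exists>U\<in>carrier_mat n n. transpose_mat U * U = 1\<^sub>m n \<and>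
           transpose_mat U * A * U = mat_diag n (\<lambda>i. es ! i))"
  using assms
proof (induction es arbitrary: n A)
  case Nil
  then have n: "n = 0" using degree_monic_char_poly[of A n] by simp
  then show ?case using Nil by (intro conjI bexI[of _ "1\<^sub>m 0"]) (auto simp: mat_diag_def)
next
  case (Cons e es n A)
  note A = Cons.prems(1) and At = Cons.prems(2) and cp = Cons.prems(3)
  have "eigenvalue A e"
    unfolding eigenvalue_root_char_poly[OF A] cp by simp
  then obtain v where v: "v \<in> carrier_vec n" and v0: "v \<noteq> 0\<^sub>v n" and Av: "A *\<^sub>v v = e \<cdot>\<^sub>v v"
    using A by (auto simp: eigenvalue_def eigenvector_def)
  obtain m where n: "n = Suc m" using v v0 by (cases n) auto
  obtain W c where W: "W \<in> carrier_mat n n" and WtW: "transpose_mat W * W = 1\<^sub>m n"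
    and W0: "col W 0 = c \<cdot>\<^sub>v v" using orthonormal_completion[OF v v0] .
  let ?Wt = "transpose_mat W"
  have Wt: "?Wt \<in> carrier_mat n n" using W by simp
  have WWt: "W * ?Wt = 1\<^sub>m n" using mat_mult_left_right_inverse[OF Wt W WtW] .
  define A' where "A' = ?Wt * A * W"
  have A': "A' \<in> carrier_mat n n" using W A by (simp add: A'_def)
  have A't: "transpose_mat A' = A'"
  proof -
    have "transpose_mat A' = ?Wt * (transpose_mat A * W)"
      using W A by (simp add: A'_def transpose_mult[of _ n n _ n])
    then show ?thesis using W A At by (simp add: A'_def assoc_mult_mat[of _ n n _ n _ n])
  qed
  have "A *\<^sub>v col W 0 = e \<cdot>\<^sub>v col W 0"
    unfolding W0 using A v by (simp add: mult_mat_vec[OF A v] Av smult_smult_assoc mult.commute)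
  moreover have "col (A * W) 0 = A *\<^sub>v col W 0" using n by (intro col_mult2[OF A W]) simp
  ultimately have AW0: "col (A * W) 0 = e \<cdot>\<^sub>v col W 0" by simp
  have A'0: "A' $$ (i, 0) = (if i = 0 then e else 0)" if i: "i < n" for i
  proof -
    have "A' $$ (i, 0) = col W i \<bullet> col (A * W) 0"
      using i n W A by (simp add: A'_def assoc_mult_mat[of _ n n _ n _ n])
    also have "\<dots> = e * (col W i \<bullet> col W 0)" using W by (simp add: AW0)
    also have "col W i \<bullet> col W 0 = (?Wt * W) $$ (i, 0)" using W i n by simp
    finally show ?thesis using i n by (simp add: WtW)
  qed
  have A'0': "A' $$ (0, i) = (if i = 0 then e else 0)" if i: "i < n" for i
    using arg_cong[OF A't, of "\<lambda>M. M $$ (0, i)"] A'0[OF i] A' i n by simp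
  define E where "E = mat 1 1 (\<lambda>_. e)"
  define B where "B = mat m m (\<lambda>(i, j). A' $$ (Suc i, Suc j))"
  have E: "E \<in> carrier_mat 1 1" and B: "B \<in> carrier_mat m m" by (auto simp: E_def B_def)
  have blocks: "A' = four_block_mat E (0\<^sub>m 1 m) (0\<^sub>m m 1) B"
    using A' A'0 A'0' n by (intro eq_matI) (auto simp: E_def B_def)
  have Bt: "transpose_mat B = B"
  proof (rule eq_matI)
    fix i j assume "i < dim_row B" "j < dim_col B"
    then have ij: "i < m" "j < m" by (auto simp: B_def)
    then show "transpose_mat B $$ (i, j) = B $$ (i, j)"
      using arg_cong[OF A't, of "\<lambda>M. M $$ (Suc i, Suc j)"] A' n by (simp add: B_def)
  qed (auto simp: B_def)
  have "similar_mat_wit A' A ?Wt W"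
    using W Wt A A' WtW WWt by (intro similar_mat_witI[of _ _ n]) (auto simp: A'_def)
  then have "char_poly A' = char_poly A" by (intro char_poly_similar) (auto simp: similar_mat_def)
  moreover have "char_poly A' = char_poly E * char_poly B"
    unfolding blocks by (rule char_poly_four_block_zeros_col[OF E _ B]) simp
  moreover have "char_poly E = [:- e, 1:]"
    by (simp add: E_def char_poly_defs det_def sign_def)
  ultimately have "[:- e, 1:] * char_poly B = [:- e, 1:] * (\<Prod>e\<leftarrow>es. [:- e, 1:])"
    using cp by (simp only: list.map prod_list.Cons)
  then have cpB: "char_poly B = (\<Prod>e\<leftarrow>es. [:- e, 1:])"
    by (subst (asm) mult_left_cancel) simp_all
  obtain U' where len: "length es = m" and U': "U' \<in> carrier_mat m m"
    and U'U': "transpose_mat U' * U' = 1\<^sub>m m"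
    and diag: "transpose_mat U' * B * U' = mat_diag m (\<lambda>i. es ! i)"
    using Cons.IH[OF B Bt cpB] by blast
  define F where "F = four_block_mat (1\<^sub>m 1) (0\<^sub>m 1 m) (0\<^sub>m m 1) U'"
  have F: "F \<in> carrier_mat n n"
    unfolding F_def n using four_block_carrier_mat[OF one_carrier_mat[of 1] U'] by simp
  have Ft: "transpose_mat F = four_block_mat (1\<^sub>m 1) (0\<^sub>m 1 m) (0\<^sub>m m 1) (transpose_mat U')"
    unfolding F_def using U' by (subst transpose_four_block_mat) auto
  have FtF: "transpose_mat F * F = 1\<^sub>m n"
    unfolding Ft unfolding F_def using U'
    by (subst mult_four_block_mat[of _ 1 1 _ m _ m _ _ 1 _ m])
       (auto simp: U'U' n intro!: eq_matI)
  have "transpose_mat F * A' = four_block_mat E (0\<^sub>m 1 m) (0\<^sub>m m 1) (transpose_mat U' * B)"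
    unfolding Ft blocks using U' E B
    by (subst mult_four_block_mat[of _ 1 1 _ m _ m _ _ 1 _ m]) auto
  then have "transpose_mat F * A' * F
      = four_block_mat E (0\<^sub>m 1 m) (0\<^sub>m m 1) (transpose_mat U' * B * U')"
    unfolding F_def using U' E B
    by (simp, subst mult_four_block_mat[of _ 1 1 _ m _ m _ _ 1 _ m]) auto
  also have "\<dots> = mat_diag n (\<lambda>i. (e # es) ! i)"
    unfolding diag using n by (intro eq_matI) (auto simp: E_def mat_diag_def nth_Cons')
  finally have diagF: "transpose_mat F * A' * F = mat_diag n (\<lambda>i. (e # es) ! i)" .
  note assoc = assoc_mult_mat[of _ n n _ n _ n]
  have WFt: "transpose_mat (W * F) = transpose_mat F * ?Wt"
    by (rule transpose_mult[OF W F])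
  have Ftc: "transpose_mat F \<in> carrier_mat n n" using F by simp
  have "transpose_mat (W * F) * (W * F) = transpose_mat F * (?Wt * W * F)"
    unfolding WFt using W F by (simp add: assoc)
  then have orth: "transpose_mat (W * F) * (W * F) = 1\<^sub>m n" using F by (simp add: WtW FtF)
  have "transpose_mat (W * F) * A * (W * F) = transpose_mat F * A' * F"
    unfolding WFt A'_def using W F A by (simp add: assoc)
  then show ?case
    using W F orth diagF len n by (intro conjI bexI[of _ "W * F"]) auto
qed

lemma proots_linear_factors: "proots (\<Prod>e\<leftarrow>es. [:- e, 1:]) = mset (es :: real list)"
proof (induction es)
  case (Cons e es)
  have "(\<Prod>e\<leftarrow>es. [:- e, 1:]) \<noteq> 0" by (auto simp: prod_list_zero_iff)
  then show ?case using Cons by (simp add: proots_mult del: mult_pCons_left)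
qed simp

text \<open>
  Prescribing the sorted list of roots on the diagonal makes the \<open>k\<close>-th diagonal entry the \<open>k\<close>-th
  eigenvalue. Columns are numbered from 0 and eigenvalues from 1.
\<close>
lemma symmetric_eigenbasis:
  assumes A: "real_symmetric n A"
  obtains U where "U \<in> carrier_mat n n" "transpose_mat U * U = 1\<^sub>m n"
    "transpose_mat U * A * U = mat_diag n (\<lambda>i. eigval (Suc i) A)"
    "\<And>i j. i \<le> j \<Longrightarrow> j < n \<Longrightarrow> eigval (Suc i) A \<le> eigval (Suc j) A"
proof -
  obtain es where es: "char_poly A = (\<Prod>e\<leftarrow>es. [:- e, 1:])"
    using char_poly_real_symmetric_splits[OF A] .
  have ev: "eigval (Suc i) A = sort es ! i" for i
    by (simp add: eigval_def es proots_linear_factors)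
  have "prod_mset (mset (map (\<lambda>e. [:- e, 1:]) es)) = prod_mset (mset (map (\<lambda>e. [:- e, 1:]) (sort es)))"
    unfolding mset_map mset_sort ..
  then have "char_poly A = (\<Prod>e\<leftarrow>sort es. [:- e, 1:])"
    unfolding es prod_mset_prod_list .
  with A obtain U where "length (sort es) = n" "U \<in> carrier_mat n n"
    "transpose_mat U * U = 1\<^sub>m n" "transpose_mat U * A * U = mat_diag n (\<lambda>i. sort es ! i)"
    using orthogonal_diagonalization[of A n "sort es"] by (auto simp: real_symmetric_def)
  then show thesis using that[of U] by (simp add: ev sorted_nth_mono)
qed

section \<open>Courant-Fischer comparison along a linear map\<close>

text \<open>
  Gaussian elimination: an equation with a nonzero coefficient is solved for one of the unknowns,
  which is then eliminated from the other equations.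
\<close>
lemma underdetermined_homogeneous_system:
  fixes f :: "'j \<Rightarrow> 'i \<Rightarrow> 'k :: field"
  assumes "finite J" "finite I" "card J < card I"
  shows "\<exists>c. (\<exists>i\<in>I. c i \<noteq> 0) \<and> (\<forall>j\<in>J. (\<Sum>i\<in>I. f j i * c i) = 0)"
  using assms
proof (induction J arbitrary: I f rule: finite_induct)
  case empty
  then obtain i where "i \<in> I" by fastforce
  then show ?case by (intro exI[of _ "\<lambda>_. 1"]) auto
next
  case (insert j0 J)
  show ?case
  proof (cases "\<forall>i\<in>I. f j0 i = 0")
    case True
    obtain c where "\<exists>i\<in>I. c i \<noteq> 0" "\<forall>j\<in>J. (\<Sum>i\<in>I. f j i * c i) = 0"
      using insert.IH[of I f] insert.prems insert.hyps by auto
    then show ?thesis using True by (intro exI[of _ c]) auto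
  next
    case False
    then obtain i0 where i0: "i0 \<in> I" "f j0 i0 \<noteq> 0" by blast
    define I' where "I' = I - {i0}"
    have I: "I = insert i0 I'" "i0 \<notin> I'" "finite I'" using i0 insert.prems by (auto simp: I'_def)
    define g where "g j i = f j i - f j i0 * f j0 i / f j0 i0" for j i
    have "card J < card I'" using insert.prems insert.hyps I by simp
    then obtain c where c: "\<exists>i\<in>I'. c i \<noteq> 0" "\<forall>j\<in>J. (\<Sum>i\<in>I'. g j i * c i) = 0"
      using insert.IH[of I' g] I by auto
    define s where "s = (\<Sum>i\<in>I'. f j0 i * c i)"
    define c' where "c' = c(i0 := - s / f j0 i0)"
    have sum: "(\<Sum>i\<in>I. f j i * c' i) = (\<Sum>i\<in>I'. g j i * c i)" for j
    proof -
      have "(\<Sum>i\<in>I'. f j i * c' i) = (\<Sum>i\<in>I'. f j i * c i)"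
        using I by (intro sum.cong) (auto simp: c'_def)
      then have "(\<Sum>i\<in>I. f j i * c' i) = f j i0 * (- s / f j0 i0) + (\<Sum>i\<in>I'. f j i * c i)"
        unfolding I(1) using I(2,3) by (simp add: c'_def)
      also have "\<dots> = (\<Sum>i\<in>I'. f j i * c i) - (\<Sum>i\<in>I'. f j i0 * f j0 i / f j0 i0 * c i)"
        by (simp add: s_def sum_divide_distrib sum_distrib_left mult.assoc sum_negf)
      also have "\<dots> = (\<Sum>i\<in>I'. g j i * c i)"
        by (simp add: g_def left_diff_distrib sum_subtractf)
      finally show ?thesis .
    qed
    have "g j0 i = 0" for i using i0 by (simp add: g_def)
    then have "\<forall>j\<in>insert j0 J. (\<Sum>i\<in>I. f j i * c' i) = 0" using c by (auto simp: sum)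
    moreover have "\<exists>i\<in>I. c' i \<noteq> 0" using c(1) I by (auto simp: c'_def)
    ultimately show ?thesis by blast
  qed
qed

text \<open>
  The entries of \<open>transpose_mat U *\<^sub>v x\<close> are the coordinates of \<open>x\<close> in the eigenbasis formed by the
  columns of \<open>U\<close>, and in these coordinates the form is diagonal.
\<close>
lemma quadratic_form_in_eigenbasis:
  fixes U A :: "real mat"
  assumes U: "U \<in> carrier_mat n n" "transpose_mat U * U = 1\<^sub>m n"
    and A: "A \<in> carrier_mat n n" "transpose_mat U * A * U = mat_diag n l"
    and x: "x \<in> carrier_vec n"
  shows "x \<bullet> (A *\<^sub>v x) = (\<Sum>i<n. l i * ((transpose_mat U *\<^sub>v x) $ i)\<^sup>2)"
proof -
  define z where "z = transpose_mat U *\<^sub>v x"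
  have Ut: "transpose_mat U \<in> carrier_mat n n" using U by simp
  have z: "z \<in> carrier_vec n" using Ut x by (simp add: z_def)
  have "U * transpose_mat U = 1\<^sub>m n" using mat_mult_left_right_inverse[OF Ut U(1) U(2)] .
  then have xz: "x = U *\<^sub>v z"
    using U(1) Ut x unfolding z_def by (simp flip: assoc_mult_mat_vec)
  have "x \<bullet> (A *\<^sub>v x) = (U *\<^sub>v z) \<bullet> (A *\<^sub>v (U *\<^sub>v z))" by (simp add: xz)
  also have "\<dots> = z \<bullet> (transpose_mat U *\<^sub>v (A *\<^sub>v (U *\<^sub>v z)))"
    using transpose_vec_mult_scalar[OF Ut, of "A *\<^sub>v (U *\<^sub>v z)" z] U(1) A(1) z by simp
  also have "\<dots> = z \<bullet> ((transpose_mat U * A * U) *\<^sub>v z)"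
    using U(1) Ut A(1) z by (simp add: assoc_mult_mat_vec[of _ n n _ n])
  also have "\<dots> = (\<Sum>i<n. z $ i * (l i * z $ i))"
  proof -
    have "(mat_diag n l *\<^sub>v z) $ i = l i * z $ i" if "i < n" for i
      using that z by (simp add: mat_diag_def scalar_prod_def if_distrib[of "\<lambda>a. a * _"] cong: if_cong)
    then show ?thesis
      unfolding A(2) scalar_prod_def using z by (simp add: atLeast0LessThan mat_diag_def)
  qed
  finally show ?thesis by (simp add: z_def power2_eq_square mult_ac)
qed

lemma norm_in_orthonormal_basis:
  fixes U :: "real mat"
  assumes U: "U \<in> carrier_mat n n" "transpose_mat U * U = 1\<^sub>m n" and x: "x \<in> carrier_vec n"
  shows "x \<bullet> x = (\<Sum>i<n. ((transpose_mat U *\<^sub>v x) $ i)\<^sup>2)"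
  using quadratic_form_in_eigenbasis[OF U one_carrier_mat, of "\<lambda>_. 1" x] U x by simp

text \<open>
  A vector that involves only eigenvectors for eigenvalues at most \<open>a\<close> has Rayleigh quotient at most \<open>a\<close>.
  The condition on nonzero coordinates expresses membership in the span of these eigenvectors.
\<close>
lemma quadratic_form_le_on_eigenspaces:
  fixes U A :: "real mat"
  assumes U: "U \<in> carrier_mat n n" "transpose_mat U * U = 1\<^sub>m n"
    and A: "A \<in> carrier_mat n n" "transpose_mat U * A * U = mat_diag n l"
    and x: "x \<in> carrier_vec n"
    and le: "\<And>i. i < n \<Longrightarrow> (transpose_mat U *\<^sub>v x) $ i \<noteq> 0 \<Longrightarrow> l i \<le> a"
  shows "x \<bullet> (A *\<^sub>v x) \<le> a * (x \<bullet> x)"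
  unfolding quadratic_form_in_eigenbasis[OF U A x] norm_in_orthonormal_basis[OF U x] sum_distrib_left
proof (rule sum_mono)
  fix i assume "i \<in> {..<n}"
  then show "l i * ((transpose_mat U *\<^sub>v x) $ i)\<^sup>2 \<le> a * ((transpose_mat U *\<^sub>v x) $ i)\<^sup>2"
    using le[of i] by (cases "(transpose_mat U *\<^sub>v x) $ i = 0") (auto intro: mult_right_mono)
qed

lemma quadratic_form_ge_on_eigenspaces:
  fixes U A :: "real mat"
  assumes U: "U \<in> carrier_mat n n" "transpose_mat U * U = 1\<^sub>m n"
    and A: "A \<in> carrier_mat n n" "transpose_mat U * A * U = mat_diag n l"
    and x: "x \<in> carrier_vec n"
    and ge: "\<And>i. i < n \<Longrightarrow> (transpose_mat U *\<^sub>v x) $ i \<noteq> 0 \<Longrightarrow> a \<le> l i"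
  shows "a * (x \<bullet> x) \<le> x \<bullet> (A *\<^sub>v x)"
  unfolding quadratic_form_in_eigenbasis[OF U A x] norm_in_orthonormal_basis[OF U x] sum_distrib_left
proof (rule sum_mono)
  fix i assume "i \<in> {..<n}"
  then show "a * ((transpose_mat U *\<^sub>v x) $ i)\<^sup>2 \<le> l i * ((transpose_mat U *\<^sub>v x) $ i)\<^sup>2"
    using ge[of i] by (cases "(transpose_mat U *\<^sub>v x) $ i = 0") (auto intro: mult_right_mono)
qed

text \<open>
  The vectors sought are the \<open>y\<close> in the span of the columns \<open>I\<close> of \<open>W\<close> with \<open>T y\<close> in the span of the
  columns \<open>J\<close> of \<open>U\<close>. The coordinates of \<open>y\<close> are \<open>card I\<close> unknowns, and the condition on \<open>T y\<close> amounts to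
  one equation for each of the fewer than \<open>card I\<close> columns outside \<open>J\<close>.
\<close>
lemma common_vector_by_dimension:
  fixes U W T :: "real mat"
  assumes U: "U \<in> carrier_mat n n"
    and W: "W \<in> carrier_mat p p" "transpose_mat W * W = 1\<^sub>m p"
    and T: "T \<in> carrier_mat n p"
    and I: "I \<subseteq> {..<p}" and J: "J \<subseteq> {..<n}" and card: "n < card I + card J"
  obtains y where "y \<in> carrier_vec p" "y \<noteq> 0\<^sub>v p"
    "\<And>i. i < p \<Longrightarrow> (transpose_mat W *\<^sub>v y) $ i \<noteq> 0 \<Longrightarrow> i \<in> I"
    "\<And>j. j < n \<Longrightarrow> (transpose_mat U *\<^sub>v (T *\<^sub>v y)) $ j \<noteq> 0 \<Longrightarrow> j \<in> J"
proof -
  define N where "N = transpose_mat U * (T * W)"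
  have Ut: "transpose_mat U \<in> carrier_mat n n" and Wt: "transpose_mat W \<in> carrier_mat p p"
    and N: "N \<in> carrier_mat n p"
    using U W T by (auto simp: N_def)
  have fin: "finite I" "finite J" using I J by (auto intro: finite_subset)
  have "card ({..<n} - J) < card I" using card J fin card_mono[OF _ J] by (simp add: card_Diff_subset)
  then obtain c where c0: "\<exists>i\<in>I. c i \<noteq> 0"
    and c: "\<forall>j\<in>{..<n} - J. (\<Sum>i\<in>I. N $$ (j, i) * c i) = 0"
    using underdetermined_homogeneous_system[of "{..<n} - J" I "\<lambda>j i. N $$ (j, i)"] fin by auto
  define z where "z = vec p (\<lambda>i. if i \<in> I then c i else 0)"
  define y where "y = W *\<^sub>v z"
  have z: "z \<in> carrier_vec p" by (simp add: z_def)
  have y: "y \<in> carrier_vec p" using W z by (simp add: y_def)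
  have Wy: "transpose_mat W *\<^sub>v y = z"
    unfolding y_def using W Wt z by (simp flip: assoc_mult_mat_vec)
  have UTy: "transpose_mat U *\<^sub>v (T *\<^sub>v y) = N *\<^sub>v z"
    unfolding y_def N_def using Ut T W z by (simp add: assoc_mult_mat_vec[of _ n n _ p])
  show thesis
  proof (rule that[OF y])
    obtain i where "i \<in> I" "c i \<noteq> 0" using c0 by blast
    then have "z $ i \<noteq> 0" "i < p" using I by (auto simp: z_def)
    then have "z \<noteq> 0\<^sub>v p" by auto
    then show "y \<noteq> 0\<^sub>v p" using Wy Wt by auto
    show "i \<in> I" if "i < p" "(transpose_mat W *\<^sub>v y) $ i \<noteq> 0" for i
      using that unfolding Wy by (auto simp: z_def split: if_splits)
    show "j \<in> J" if j: "j < n" "(transpose_mat U *\<^sub>v (T *\<^sub>v y)) $ j \<noteq> 0" for j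
    proof (rule ccontr)
      assume "j \<notin> J"
      have "(N *\<^sub>v z) $ j = (\<Sum>i<p. N $$ (j, i) * (if i \<in> I then c i else 0))"
        using N j by (simp add: scalar_prod_def z_def atLeast0LessThan)
      also have "\<dots> = (\<Sum>i\<in>I. N $$ (j, i) * c i)"
        using I by (intro sum.mono_neutral_cong_right) auto
      finally show False using c j \<open>j \<notin> J\<close> UTy by auto
    qed
  qed
qed

text \<open>
  This is one half of the Courant-Fischer principle, with one vector serving both matrices: the \<open>k\<close>
  lowest eigenvectors of \<open>B\<close> and the \<open>n - k + 1\<close> highest ones of \<open>A\<close> give dimensions adding up to
  \<open>n + 1\<close>.
\<close>
lemma min_max_below:
  assumes A: "real_symmetric n A" and B: "real_symmetric p B" and T: "T \<in> carrier_mat n p"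
    and k: "1 \<le> k" "k \<le> p" "k \<le> n"
  obtains y where "y \<in> carrier_vec p" "y \<noteq> 0\<^sub>v p"
    "y \<bullet> (B *\<^sub>v y) \<le> eigval k B * (y \<bullet> y)"
    "eigval k A * ((T *\<^sub>v y) \<bullet> (T *\<^sub>v y)) \<le> (T *\<^sub>v y) \<bullet> (A *\<^sub>v (T *\<^sub>v y))"
proof -
  obtain U where U: "U \<in> carrier_mat n n" "transpose_mat U * U = 1\<^sub>m n"
    "transpose_mat U * A * U = mat_diag n (\<lambda>i. eigval (Suc i) A)"
    and monoA: "\<And>i j. i \<le> j \<Longrightarrow> j < n \<Longrightarrow> eigval (Suc i) A \<le> eigval (Suc j) A"
    using symmetric_eigenbasis[OF A] by metis
  obtain W where W: "W \<in> carrier_mat p p" "transpose_mat W * W = 1\<^sub>m p"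
    "transpose_mat W * B * W = mat_diag p (\<lambda>i. eigval (Suc i) B)"
    and monoB: "\<And>i j. i \<le> j \<Longrightarrow> j < p \<Longrightarrow> eigval (Suc i) B \<le> eigval (Suc j) B"
    using symmetric_eigenbasis[OF B] by metis
  have Ac: "A \<in> carrier_mat n n" and Bc: "B \<in> carrier_mat p p"
    using A B by (auto simp: real_symmetric_def)
  have dims: "{..<k} \<subseteq> {..<p}" "{k - 1..<n} \<subseteq> {..<n}"
    "n < card {..<k} + card {k - 1..<n}"
    using k by auto
  obtain y where y: "y \<in> carrier_vec p" "y \<noteq> 0\<^sub>v p"
    and WI: "\<And>i. i < p \<Longrightarrow> (transpose_mat W *\<^sub>v y) $ i \<noteq> 0 \<Longrightarrow> i \<in> {..<k}"
    and UJ: "\<And>j. j < n \<Longrightarrow> (transpose_mat U *\<^sub>v (T *\<^sub>v y)) $ j \<noteq> 0 \<Longrightarrow> j \<in> {k - 1..<n}"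
    using common_vector_by_dimension[OF U(1) W(1,2) T dims] by blast
  have Ty: "T *\<^sub>v y \<in> carrier_vec n" using T y by simp
  show thesis
  proof (rule that[OF y])
    show "y \<bullet> (B *\<^sub>v y) \<le> eigval k B * (y \<bullet> y)"
      using monoB[of _ "k - 1"] WI k
      by (intro quadratic_form_le_on_eigenspaces[OF W(1,2) Bc W(3) y(1)]) force
    show "eigval k A * ((T *\<^sub>v y) \<bullet> (T *\<^sub>v y)) \<le> (T *\<^sub>v y) \<bullet> (A *\<^sub>v (T *\<^sub>v y))"
      using monoA[of "k - 1"] UJ k
      by (intro quadratic_form_ge_on_eigenspaces[OF U(1,2) Ac U(3) Ty]) force
  qed
qed

text \<open>
  The dual half: the \<open>p - k + 1\<close> highest eigenvectors of \<open>B\<close> and the \<open>n - p + k\<close> lowest ones of \<open>A\<close> again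
  give dimensions adding up to \<open>n + 1\<close>.
\<close>
lemma min_max_above:
  assumes A: "real_symmetric n A" and B: "real_symmetric p B" and T: "T \<in> carrier_mat n p"
    and k: "1 \<le> k" "k \<le> p" "p \<le> n"
  obtains y where "y \<in> carrier_vec p" "y \<noteq> 0\<^sub>v p"
    "eigval k B * (y \<bullet> y) \<le> y \<bullet> (B *\<^sub>v y)"
    "(T *\<^sub>v y) \<bullet> (A *\<^sub>v (T *\<^sub>v y)) \<le> eigval (n - p + k) A * ((T *\<^sub>v y) \<bullet> (T *\<^sub>v y))"
proof -
  obtain U where U: "U \<in> carrier_mat n n" "transpose_mat U * U = 1\<^sub>m n"
    "transpose_mat U * A * U = mat_diag n (\<lambda>i. eigval (Suc i) A)"
    and monoA: "\<And>i j. i \<le> j \<Longrightarrow> j < n \<Longrightarrow> eigval (Suc i) A \<le> eigval (Suc j) A"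
    using symmetric_eigenbasis[OF A] by metis
  obtain W where W: "W \<in> carrier_mat p p" "transpose_mat W * W = 1\<^sub>m p"
    "transpose_mat W * B * W = mat_diag p (\<lambda>i. eigval (Suc i) B)"
    and monoB: "\<And>i j. i \<le> j \<Longrightarrow> j < p \<Longrightarrow> eigval (Suc i) B \<le> eigval (Suc j) B"
    using symmetric_eigenbasis[OF B] by metis
  have Ac: "A \<in> carrier_mat n n" and Bc: "B \<in> carrier_mat p p"
    using A B by (auto simp: real_symmetric_def)
  have last: "Suc (n - p + k - 1) = n - p + k" using k by simp
  have dims: "{k - 1..<p} \<subseteq> {..<p}" "{..<n - p + k} \<subseteq> {..<n}"
    "n < card {k - 1..<p} + card {..<n - p + k}"
    using k by auto
  obtain y where y: "y \<in> carrier_vec p" "y \<noteq> 0\<^sub>v p"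
    and WI: "\<And>i. i < p \<Longrightarrow> (transpose_mat W *\<^sub>v y) $ i \<noteq> 0 \<Longrightarrow> i \<in> {k - 1..<p}"
    and UJ: "\<And>j. j < n \<Longrightarrow> (transpose_mat U *\<^sub>v (T *\<^sub>v y)) $ j \<noteq> 0 \<Longrightarrow> j \<in> {..<n - p + k}"
    using common_vector_by_dimension[OF U(1) W(1,2) T dims] by blast
  have Ty: "T *\<^sub>v y \<in> carrier_vec n" using T y by simp
  show thesis
  proof (rule that[OF y])
    show "eigval k B * (y \<bullet> y) \<le> y \<bullet> (B *\<^sub>v y)"
      using monoB[of "k - 1"] WI k
      by (intro quadratic_form_ge_on_eigenspaces[OF W(1,2) Bc W(3) y(1)]) force
    show "(T *\<^sub>v y) \<bullet> (A *\<^sub>v (T *\<^sub>v y)) \<le> eigval (n - p + k) A * ((T *\<^sub>v y) \<bullet> (T *\<^sub>v y))"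
      using monoA[of _ "n - p + k - 1", unfolded last] UJ k
      by (intro quadratic_form_le_on_eigenspaces[OF U(1,2) Ac U(3) Ty]) force
  qed
qed

section \<open>The Laplacian as the Dirichlet energy\<close>

text \<open>
  Counting every edge in both directions avoids choosing an orientation; the energy is halved
  accordingly.
\<close>
definition arcs :: "'a ugraph \<Rightarrow> ('a \<times> 'a) set" where
  "arcs G = {(u, v) \<in> verts G \<times> verts G. adjacent G u v}"

definition dirichlet_energy :: "'a ugraph \<Rightarrow> ('a \<Rightarrow> real) \<Rightarrow> real" where
  "dirichlet_energy G f = (\<Sum>(u, v)\<in>arcs G. (f u - f v)\<^sup>2) / 2"

lemma adjacent_commute: "adjacent G u v = adjacent G v u"
  by (simp add: adjacent_def insert_commute)

lemma not_adjacent_self: "simple_graph G \<Longrightarrow> \<not> adjacent G u u"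
  unfolding simple_graph_def adjacent_def by fastforce

lemma finite_arcs: "simple_graph G \<Longrightarrow> finite (arcs G)"
  by (rule finite_subset[of _ "verts G \<times> verts G"]) (auto simp: simple_graph_def arcs_def)

lemma finite_edges: "simple_graph G \<Longrightarrow> finite (edges G)"
  by (rule finite_subset[of _ "Pow (verts G)"]) (auto simp: simple_graph_def)

lemma dirichlet_energy_nonneg: "dirichlet_energy G f \<ge> 0"
  by (auto simp: dirichlet_energy_def intro!: sum_nonneg)

lemma real_symmetric_laplacian:
  assumes "card (verts G) = n"
  shows "real_symmetric n (laplacian \<nu> G)"
  using assms by (auto simp: real_symmetric_def laplacian_def adjacent_commute intro!: eq_matI)

text \<open>
  At the vertex \<open>u\<close> the Laplacian yields the sum of \<open>f u - f v\<close> over the neighbours \<open>v\<close> of \<open>u\<close>. In the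
  resulting double sum of \<open>f u * (f u - f v)\<close>, averaging the contributions of an arc and of its
  reverse produces the squares.
\<close>
lemma laplacian_quadratic_form:
  assumes G: "simple_graph G" and \<nu>: "bij_betw \<nu> {0..<n} (verts G)"
  defines "x \<equiv> \<lambda>f. vec n (\<lambda>i. f (\<nu> i))"
  shows "x f \<bullet> (laplacian \<nu> G *\<^sub>v x f) = dirichlet_energy G f"
proof -
  let ?V = "verts G"
  let ?S = "\<lambda>h. \<Sum>u\<in>?V. \<Sum>v\<in>?V. if adjacent G u v then h u v else 0 :: real"
  have n: "card ?V = n" using bij_betw_same_card[OF \<nu>] by simp
  have fin: "finite ?V" using G by (simp add: simple_graph_def)
  have reindex: "(\<Sum>i = 0..<n. h (\<nu> i)) = (\<Sum>u\<in>?V. h u)" for h :: "_ \<Rightarrow> real"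
    using sum.reindex_bij_betw[OF \<nu>] .
  have entry: "(laplacian \<nu> G *\<^sub>v x f) $ i
      = (\<Sum>v\<in>?V. if adjacent G (\<nu> i) v then f (\<nu> i) - f v else 0)" if i: "i < n" for i
  proof -
    let ?d = "real (vertex_degree G (\<nu> i))"
    have "(laplacian \<nu> G *\<^sub>v x f) $ i = (\<Sum>j = 0..<n. laplacian \<nu> G $$ (i, j) * f (\<nu> j))"
      using i n by (simp add: laplacian_def scalar_prod_def x_def)
    also have "\<dots> = (\<Sum>j = 0..<n. (if j = i then ?d * f (\<nu> i) else 0)
        - (if adjacent G (\<nu> i) (\<nu> j) then f (\<nu> j) else 0))"
      using i n not_adjacent_self[OF G] by (intro sum.cong) (auto simp: laplacian_def)
    also have "\<dots> = ?d * f (\<nu> i) - (\<Sum>v\<in>?V. if adjacent G (\<nu> i) v then f v else 0)"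
      using i by (simp add: sum_subtractf reindex[of "\<lambda>v. if adjacent G (\<nu> i) v then f v else 0"])
    also have "?d * f (\<nu> i) = (\<Sum>v\<in>?V. if adjacent G (\<nu> i) v then f (\<nu> i) else 0)"
      using fin by (simp add: vertex_degree_def sum.inter_filter[symmetric])
    finally show ?thesis by (simp add: sum_subtractf[symmetric] if_distrib cong: if_cong)
  qed
  have "x f \<bullet> (laplacian \<nu> G *\<^sub>v x f) = (\<Sum>i = 0..<n. x f $ i * (laplacian \<nu> G *\<^sub>v x f) $ i)"
    using n by (simp add: scalar_prod_def laplacian_def)
  also have "\<dots> = (\<Sum>i = 0..<n. f (\<nu> i)
      * (\<Sum>v\<in>?V. if adjacent G (\<nu> i) v then f (\<nu> i) - f v else 0))"
    by (intro sum.cong refl arg_cong2[where f = "(*)"] entry) (auto simp: x_def)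
  also have "\<dots> = ?S (\<lambda>u v. f u * (f u - f v))"
    unfolding reindex[of "\<lambda>u. f u * (\<Sum>v\<in>?V. if adjacent G u v then f u - f v else 0)"]
    by (simp add: sum_distrib_left if_distrib cong: if_cong)
  finally have form: "x f \<bullet> (laplacian \<nu> G *\<^sub>v x f) = ?S (\<lambda>u v. f u * (f u - f v))" .
  have "?S (\<lambda>u v. f u * (f u - f v)) = ?S (\<lambda>u v. f v * (f v - f u))"
    by (subst sum.swap) (simp add: adjacent_commute)
  then have "2 * ?S (\<lambda>u v. f u * (f u - f v))
      = ?S (\<lambda>u v. f u * (f u - f v)) + ?S (\<lambda>u v. f v * (f v - f u))" by simp
  also have "\<dots> = ?S (\<lambda>u v. (f u - f v)\<^sup>2)"
    unfolding sum.distrib[symmetric]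
    by (intro sum.cong refl) (simp add: power2_eq_square algebra_simps)
  also have "\<dots> = (\<Sum>(u, v)\<in>arcs G. (f u - f v)\<^sup>2)"
    using fin unfolding arcs_def sum.cartesian_product
    by (intro sum.mono_neutral_cong_right) (auto split: if_splits)
  finally show ?thesis using form by (simp add: dirichlet_energy_def)
qed

lemma norm_of_vertex_function:
  assumes "bij_betw \<nu> {0..<n} V"
  shows "vec n (\<lambda>i. f (\<nu> i)) \<bullet> vec n (\<lambda>i. f (\<nu> i)) = (\<Sum>u\<in>V. (f u)\<^sup>2 :: real)"
  using sum.reindex_bij_betw[OF assms, of "\<lambda>u. (f u)\<^sup>2"]
  by (simp add: scalar_prod_def power2_eq_square)

section \<open>From energies to eigenvalues\<close>

text \<open>
  The matrix of \<open>g \<mapsto> g \<circ> c\<close> from functions on \<open>{1..p}\<close> to functions on the vertices. The value 0 of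
  \<open>c\<close> serves for vertices at which the result vanishes; such rows are zero.
\<close>
definition pullback_mat :: "nat \<Rightarrow> nat \<Rightarrow> ('a \<Rightarrow> nat) \<Rightarrow> (nat \<Rightarrow> 'a) \<Rightarrow> real mat" where
  "pullback_mat n p c \<nu> = mat n p (\<lambda>(i, j). if c (\<nu> i) = Suc j then 1 else 0)"

lemma pullback_mat_carrier: "pullback_mat n p c \<nu> \<in> carrier_mat n p"
  by (simp add: pullback_mat_def)

lemma pullback_mat_mult:
  assumes "g 0 = 0" and "\<And>i. i < n \<Longrightarrow> c (\<nu> i) \<le> p"
  shows "pullback_mat n p c \<nu> *\<^sub>v vec p (\<lambda>j. g (Suc j)) = vec n (\<lambda>i. g (c (\<nu> i)))"
proof (rule eq_vecI)
  fix i assume "i < dim_vec (vec n (\<lambda>i. g (c (\<nu> i))))"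
  then have i: "i < n" by simp
  then have "(pullback_mat n p c \<nu> *\<^sub>v vec p (\<lambda>j. g (Suc j))) $ i
      = (\<Sum>j = 0..<p. if c (\<nu> i) = Suc j then g (Suc j) else 0)"
    by (auto simp: pullback_mat_def scalar_prod_def intro!: sum.cong)
  also have "\<dots> = g (c (\<nu> i))"
    using assms(1) assms(2)[OF i] by (cases "c (\<nu> i)") auto
  finally show "(pullback_mat n p c \<nu> *\<^sub>v vec p (\<lambda>j. g (Suc j))) $ i
      = vec n (\<lambda>i. g (c (\<nu> i))) $ i" using i by simp
qed (simp add: pullback_mat_def)

lemma vec_as_vertex_function:
  assumes "y \<in> carrier_vec p"
  obtains g where "g 0 = (0 :: real)" "y = vec p (\<lambda>j. g (Suc j))"
proof
  show "(\<lambda>j. case j of 0 \<Rightarrow> 0 | Suc i \<Rightarrow> y $ i) 0 = (0 :: real)" by simp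
  show "y = vec p (\<lambda>j. case Suc j of 0 \<Rightarrow> 0 | Suc i \<Rightarrow> y $ i)" using assms by auto
qed

lemma bij_betw_Suc_positive: "bij_betw Suc {0..<p} {1..p}"
  by (simp add: bij_betw_def atLeastLessThanSuc_atLeastAtMost image_Suc_atLeastLessThan)

text \<open>
  The energy of \<open>H\<close> is nonnegative, so the bound \<open>\<lambda>\<^sub>k(H)\<close> on the Rayleigh quotient in \<open>H\<close> is nonnegative as
  well and survives the growth of the norm under pullback along the surjection \<open>c\<close>.
\<close>
lemma eigval_le_of_energy_decrease:
  fixes G :: "'a ugraph" and H :: "nat ugraph"
  assumes G: "simple_graph G" "bij_betw \<nu> {0..<n} (verts G)"
    and H: "simple_graph H" "verts H = {1..p}"
    and k: "1 \<le> k" "k \<le> p" "k \<le> n"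
    and c: "c ` verts G = {1..p}"
    and energy: "\<And>g. dirichlet_energy G (\<lambda>u. g (c u)) \<le> dirichlet_energy H g"
  shows "eigval k (laplacian \<nu> G) \<le> eigval k (laplacian Suc H)"
proof -
  let ?A = "laplacian \<nu> G" and ?B = "laplacian Suc H" and ?T = "pullback_mat n p c \<nu>"
  have H': "bij_betw Suc {0..<p} (verts H)" using H bij_betw_Suc_positive by simp
  have A: "real_symmetric n ?A" and B: "real_symmetric p ?B"
    using bij_betw_same_card[OF G(2)] H(2) by (auto intro!: real_symmetric_laplacian)
  obtain y where y: "y \<in> carrier_vec p" "y \<noteq> 0\<^sub>v p"
    and yB: "y \<bullet> (?B *\<^sub>v y) \<le> eigval k ?B * (y \<bullet> y)"
    and yA: "eigval k ?A * ((?T *\<^sub>v y) \<bullet> (?T *\<^sub>v y)) \<le> (?T *\<^sub>v y) \<bullet> (?A *\<^sub>v (?T *\<^sub>v y))"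
    using min_max_below[OF A B pullback_mat_carrier k] .
  obtain g where g: "g 0 = 0" "y = vec p (\<lambda>j. g (Suc j))" using vec_as_vertex_function[OF y(1)] .
  have "\<nu> i \<in> verts G" if "i < n" for i using G(2) that by (auto simp: bij_betw_def)
  then have "c (\<nu> i) \<le> p" if "i < n" for i using c that by force
  then have Ty: "?T *\<^sub>v y = vec n (\<lambda>i. g (c (\<nu> i)))"
    unfolding g(2) by (rule pullback_mat_mult[of g, OF g(1)])
  have normT: "(?T *\<^sub>v y) \<bullet> (?T *\<^sub>v y) = (\<Sum>u\<in>verts G. (g (c u))\<^sup>2)"
    unfolding Ty by (rule norm_of_vertex_function[OF G(2)])
  have norm: "y \<bullet> y = (\<Sum>i\<in>{1..p}. (g i)\<^sup>2)"
    unfolding g(2) by (rule norm_of_vertex_function[OF bij_betw_Suc_positive])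
  have EA: "(?T *\<^sub>v y) \<bullet> (?A *\<^sub>v (?T *\<^sub>v y)) = dirichlet_energy G (\<lambda>u. g (c u))"
    unfolding Ty by (rule laplacian_quadratic_form[OF G])
  have EB: "y \<bullet> (?B *\<^sub>v y) = dirichlet_energy H g"
    unfolding g(2) by (rule laplacian_quadratic_form[OF H(1) H'])
  have pos: "0 < y \<bullet> y"
    using conjugate_square_greater_0_vec[OF y(1)] y(2) by simp
  have grow: "y \<bullet> y \<le> (?T *\<^sub>v y) \<bullet> (?T *\<^sub>v y)"
    unfolding norm normT c[symmetric] using G(1)
    by (intro sum_le_included[of _ _ _ c]) (auto simp: simple_graph_def)
  have "0 \<le> eigval k ?B * (y \<bullet> y)"
    using yB EB dirichlet_energy_nonneg[of H g] by linarith
  \<comment> \<open>The nonnegative energy is at most the eigenvalue times the positive squared norm.\<close>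
  then have "0 \<le> eigval k ?B" using pos by (simp add: zero_le_mult_iff)
  then have "eigval k ?B * (y \<bullet> y) \<le> eigval k ?B * ((?T *\<^sub>v y) \<bullet> (?T *\<^sub>v y))"
    using grow by (intro mult_left_mono)
  then have "eigval k ?A * ((?T *\<^sub>v y) \<bullet> (?T *\<^sub>v y)) \<le> eigval k ?B * ((?T *\<^sub>v y) \<bullet> (?T *\<^sub>v y))"
    using yA yB EA EB energy[of g] by linarith
  then show ?thesis using pos grow by (simp add: mult_le_cancel_right)
qed

text \<open>
  Here \<open>c\<close> is a bijection on \<open>V\<close> and 0 elsewhere, so pulling back along \<open>c\<close> a function that vanishes at 0
  means extending it by zero: the norm is preserved exactly, so that the Rayleigh
  quotients compare whatever the sign of the eigenvalue.
\<close>
lemma eigval_le_of_energy_increase: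
  fixes G :: "'a ugraph" and H :: "nat ugraph"
  assumes G: "simple_graph G" "bij_betw \<nu> {0..<n} (verts G)"
    and H: "simple_graph H" "verts H = {1..p}"
    and k: "1 \<le> k" "k \<le> p" "p \<le> n"
    and V: "V \<subseteq> verts G" and c: "bij_betw c V {1..p}" "\<And>u. u \<in> verts G - V \<Longrightarrow> c u = 0"
    and energy: "\<And>g. g 0 = 0 \<Longrightarrow> dirichlet_energy H g \<le> dirichlet_energy G (\<lambda>u. g (c u))"
  shows "eigval k (laplacian Suc H) \<le> eigval (n - p + k) (laplacian \<nu> G)"
proof -
  let ?A = "laplacian \<nu> G" and ?B = "laplacian Suc H" and ?T = "pullback_mat n p c \<nu>"
  have H': "bij_betw Suc {0..<p} (verts H)" using H bij_betw_Suc_positive by simp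
  have A: "real_symmetric n ?A" and B: "real_symmetric p ?B"
    using bij_betw_same_card[OF G(2)] H(2) by (auto intro!: real_symmetric_laplacian)
  obtain y where y: "y \<in> carrier_vec p" "y \<noteq> 0\<^sub>v p"
    and yB: "eigval k ?B * (y \<bullet> y) \<le> y \<bullet> (?B *\<^sub>v y)"
    and yA: "(?T *\<^sub>v y) \<bullet> (?A *\<^sub>v (?T *\<^sub>v y)) \<le> eigval (n - p + k) ?A * ((?T *\<^sub>v y) \<bullet> (?T *\<^sub>v y))"
    using min_max_above[OF A B pullback_mat_carrier k] .
  obtain g where g: "g 0 = 0" "y = vec p (\<lambda>j. g (Suc j))" using vec_as_vertex_function[OF y(1)] .
  have c_le: "c u \<le> p" if "u \<in> verts G" for u
    using that c bij_betwE[OF c(1)] by (cases "u \<in> V") auto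
  have "\<nu> i \<in> verts G" if "i < n" for i using G(2) that by (auto simp: bij_betw_def)
  then have Ty: "?T *\<^sub>v y = vec n (\<lambda>i. g (c (\<nu> i)))"
    unfolding g(2) using c_le by (intro pullback_mat_mult[of g, OF g(1)]) auto
  have "(?T *\<^sub>v y) \<bullet> (?T *\<^sub>v y) = (\<Sum>u\<in>verts G. (g (c u))\<^sup>2)"
    unfolding Ty by (rule norm_of_vertex_function[OF G(2)])
  also have "\<dots> = (\<Sum>u\<in>V. (g (c u))\<^sup>2)"
    using V c(2) g(1) G(1) by (intro sum.mono_neutral_right) (auto simp: simple_graph_def)
  also have "\<dots> = (\<Sum>i\<in>{1..p}. (g i)\<^sup>2)" by (rule sum.reindex_bij_betw[OF c(1)])
  also have "\<dots> = y \<bullet> y"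
    unfolding g(2) by (rule norm_of_vertex_function[OF bij_betw_Suc_positive, symmetric])
  finally have norm: "(?T *\<^sub>v y) \<bullet> (?T *\<^sub>v y) = y \<bullet> y" .
  have EA: "(?T *\<^sub>v y) \<bullet> (?A *\<^sub>v (?T *\<^sub>v y)) = dirichlet_energy G (\<lambda>u. g (c u))"
    unfolding Ty by (rule laplacian_quadratic_form[OF G])
  have EB: "y \<bullet> (?B *\<^sub>v y) = dirichlet_energy H g"
    unfolding g(2) by (rule laplacian_quadratic_form[OF H(1) H'])
  have pos: "0 < y \<bullet> y"
    using conjugate_square_greater_0_vec[OF y(1)] y(2) by simp
  have "eigval k ?B * (y \<bullet> y) \<le> eigval (n - p + k) ?A * (y \<bullet> y)"
    using yA yB EA EB energy[of g, OF g(1)] norm by simp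
  then show ?thesis using pos by (simp add: mult_le_cancel_right)
qed

section \<open>Node removal\<close>

text \<open>
  Extension by zero reproduces every arc of \<open>H\<close> among the remaining vertices, with the same
  difference of values; the arcs that meet a deleted vertex contribute nonnegative terms.
\<close>
lemma node_removal_eigval_le:
  fixes G :: "'a ugraph" and H :: "nat ugraph"
  assumes G: "simple_graph G" "bij_betw \<nu> {0..<n} (verts G)"
    and H: "simple_graph H" "verts H = {1..p}"
    and k: "1 \<le> k" "k \<le> p" "p \<le> n"
    and removal: "node_removal_equivalent G H"
  shows "eigval k (laplacian Suc H) \<le> eigval (n - p + k) (laplacian \<nu> G)"
proof -
  obtain S f where f: "bij_betw f {1..p} (verts G - S)"
    and iso: "\<forall>i\<in>{1..p}. \<forall>j\<in>{1..p}. adjacent H i j \<longleftrightarrow> adjacent (delete_verts G S) (f i) (f j)"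
    using removal H(2)
    by (auto simp: node_removal_equivalent_def graph_isomorphic_def delete_verts_def)
  define V where "V = verts G - S"
  define c where "c u = (if u \<in> V then inv_into {1..p} f u else 0)" for u
  have "bij_betw (inv_into {1..p} f) V {1..p}"
    using bij_betw_inv_into[OF f] by (simp add: V_def)
  then have c: "bij_betw c V {1..p}"
    by (rule bij_betw_cong[THEN iffD1, rotated]) (simp add: c_def)
  have fV: "f i \<in> V" and cf: "c (f i) = i" if "i \<in> {1..p}" for i
    using f that by (auto simp: V_def c_def bij_betw_def)
  show ?thesis
  proof (rule eigval_le_of_energy_increase[OF G H k _ c])
    fix g :: "nat \<Rightarrow> real"
    have arc: "(f i, f j) \<in> arcs G" if "(i, j) \<in> arcs H" for i j
    proof -
      have ij: "i \<in> {1..p}" "j \<in> {1..p}" "adjacent H i j" using that H by (auto simp: arcs_def)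
      then have "adjacent (delete_verts G S) (f i) (f j)" using iso by blast
      then show ?thesis
        using fV[OF ij(1)] fV[OF ij(2)] by (simp add: arcs_def V_def adjacent_def delete_verts_def)
    qed
    have "(\<Sum>(i, j)\<in>arcs H. (g i - g j)\<^sup>2) \<le> (\<Sum>(u, v)\<in>arcs G. (g (c u) - g (c v))\<^sup>2)"
    proof (rule sum_le_included[of _ _ _ "\<lambda>(u, v). (c u, c v)"])
      show "\<forall>x\<in>arcs H. \<exists>y\<in>arcs G. (case y of (u, v) \<Rightarrow> (c u, c v)) = x
          \<and> (case x of (i, j) \<Rightarrow> (g i - g j)\<^sup>2) \<le> (case y of (u, v) \<Rightarrow> (g (c u) - g (c v))\<^sup>2)"
      proof
        fix x assume x: "x \<in> arcs H"
        obtain i j where ij: "x = (i, j)" by (cases x)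
        have "i \<in> {1..p}" "j \<in> {1..p}" using x ij H by (auto simp: arcs_def)
        then show "\<exists>y\<in>arcs G. (case y of (u, v) \<Rightarrow> (c u, c v)) = x
          \<and> (case x of (i, j) \<Rightarrow> (g i - g j)\<^sup>2) \<le> (case y of (u, v) \<Rightarrow> (g (c u) - g (c v))\<^sup>2)"
          using arc[of i j] x ij cf by (intro bexI[of _ "(f i, f j)"]) auto
      qed
    qed (auto simp: finite_arcs G H)
    then show "dirichlet_energy H g \<le> dirichlet_energy G (\<lambda>u. g (c u))"
      by (simp add: dirichlet_energy_def)
  qed (auto simp: V_def c_def)
qed

section \<open>Contraction\<close>

lemma contract_simps:
  "verts (contract G p C) = {1..p}"
  "adjacent (contract G p C) i j \<longleftrightarrow>
     i \<in> {1..p} \<and> j \<in> {1..p} \<and> i \<noteq> j \<and> (\<exists>u\<in>C i. \<exists>v\<in>C j. adjacent G u v)"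
  by (auto simp: contract_def adjacent_def doubleton_eq_iff) (metis insert_commute)+

lemma simple_graph_contract: "simple_graph (contract G p C)"
  by (auto simp: simple_graph_def contract_def card_insert_if)

lemma equiv_reachability: "equiv (verts G) (reachability G)"
proof (rule equivI)
  have "symp (adjacent G)" by (rule sympI) (simp add: adjacent_commute)
  then have "symp (adjacent G)\<^sup>*\<^sup>*" by (rule symp_rtranclp)
  then show "sym (reachability G)" by (auto simp: reachability_def sym_def dest: sympD)
  show "trans (reachability G)" by (auto simp: reachability_def trans_def)
qed (auto simp: reachability_def refl_on_def)

text \<open>
  The cells are the classes of an equivalence relation on the vertices, so that every vertex has a
  unique cell, whose number is its value under \<open>c\<close>.
\<close>
lemma contraction_cell_map:
  assumes C: "bij_betw C {1..p} (contraction_partition G F)"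
  obtains c where "c ` verts G = {1..p}"
    "\<And>u i. u \<in> verts G \<Longrightarrow> i \<in> {1..p} \<Longrightarrow> u \<in> C i \<longleftrightarrow> c u = i"
    "\<And>i. i \<in> {1..p} \<Longrightarrow> C i \<subseteq> verts G"
    "\<And>u v. u \<in> verts G \<Longrightarrow> v \<in> verts G \<Longrightarrow> {u, v} \<in> F \<Longrightarrow> c u = c v"
proof -
  let ?R = "reachability \<lparr>verts = verts G, edges = F\<rparr>"
  have R: "equiv (verts G) ?R" using equiv_reachability[of "\<lparr>verts = verts G, edges = F\<rparr>"] by simp
  have img: "C ` {1..p} = verts G // ?R" and inj: "inj_on C {1..p}"
    using C by (auto simp: bij_betw_def contraction_partition_def conn_components_def)
  have sub: "C i \<subseteq> verts G" if "i \<in> {1..p}" for i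
    using img that Union_quotient[OF R] by blast
  have ex: "\<exists>i\<in>{1..p}. u \<in> C i" if "u \<in> verts G" for u
  proof -
    have "u \<in> \<Union> (C ` {1..p})" using that img Union_quotient[OF R] by simp
    then show ?thesis by blast
  qed
  have same: "i = j" if "i \<in> {1..p}" "j \<in> {1..p}" "u \<in> C i" "u \<in> C j" for u i j
  proof -
    have "C i \<in> verts G // ?R" "C j \<in> verts G // ?R" using img that by blast+
    then have "C i = C j" using quotient_disj[OF R] that(3,4) by blast
    then show ?thesis using inj_onD[OF inj _ that(1,2)] by simp
  qed
  obtain c where c: "c u \<in> {1..p}" "u \<in> C (c u)" if "u \<in> verts G" for u
    using ex by metis
  have iff: "u \<in> C i \<longleftrightarrow> c u = i" if "u \<in> verts G" "i \<in> {1..p}" for u i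
    using that c[of u] same[of i "c u" u] by auto
  show thesis
  proof (rule that[OF _ iff sub])
    show "c ` verts G = {1..p}"
    proof
      show "{1..p} \<subseteq> c ` verts G"
      proof
        fix i assume i: "i \<in> {1..p}"
        then have "C i \<in> verts G // ?R" using img by blast
        then obtain u where "u \<in> C i" using in_quotient_imp_non_empty[OF R] by blast
        then show "i \<in> c ` verts G" using iff[of u i] sub i by blast
      qed
    qed (use c in blast)
    fix u v assume uv: "u \<in> verts G" "v \<in> verts G" "{u, v} \<in> F"
    then have "(u, v) \<in> ?R" by (auto simp: reachability_def adjacent_def)
    moreover have "C (c u) \<in> verts G // ?R" using img c[OF uv(1)] by blast
    ultimately have "v \<in> C (c u)"
      using in_quotient_imp_closed[OF R] c(2)[OF uv(1)] by blast
    then show "c u = c v" using iff[OF uv(2)] c(1)[OF uv(1)] by simp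
  qed auto
qed

text \<open>
  The edges outside \<open>F\<close>, mapped to their sets of cells, cover the edges of the contraction. As there
  are equally many of both, the map cannot identify two edges.
\<close>
lemma edge_matching_inj_on_edges:
  assumes G: "simple_graph G" and match: "edge_matching G F (contract G p C)"
    and c: "c ` verts G = {1..p}"
    and C: "\<And>u i. u \<in> verts G \<Longrightarrow> i \<in> {1..p} \<Longrightarrow> u \<in> C i \<longleftrightarrow> c u = i"
    and sub: "\<And>i. i \<in> {1..p} \<Longrightarrow> C i \<subseteq> verts G"
    and F: "\<And>u v. u \<in> verts G \<Longrightarrow> v \<in> verts G \<Longrightarrow> {u, v} \<in> F \<Longrightarrow> c u = c v"
  shows "inj_on (image c) (edges G - F)"
proof -
  let ?H = "contract G p C"
  have fin: "finite (edges G - F)" using finite_edges[OF G] by simp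
  have "edges ?H \<subseteq> image c ` (edges G - F)"
  proof
    fix e assume "e \<in> edges ?H"
    then obtain i j u v where e: "e = {i, j}" "i \<in> {1..p}" "j \<in> {1..p}" "i \<noteq> j"
      and uv: "u \<in> C i" "v \<in> C j" "adjacent G u v" by (auto simp: contract_def)
    have "u \<in> verts G" "v \<in> verts G" using sub e uv by auto
    then have "c u = i" "c v = j" using C e uv by auto
    moreover from this have "{u, v} \<notin> F" using F \<open>u \<in> verts G\<close> \<open>v \<in> verts G\<close> e(4) by blast
    ultimately show "e \<in> image c ` (edges G - F)"
      using e uv by (intro image_eqI[of _ _ "{u, v}"]) (auto simp: adjacent_def)
  qed
  then have "card (edges ?H) \<le> card (image c ` (edges G - F))" using fin by (intro card_mono) auto
  moreover have "card (edges G - F) = card (edges ?H)"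
    using match bij_betw_same_card by (auto simp: edge_matching_def)
  ultimately have "card (image c ` (edges G - F)) = card (edges G - F)"
    using card_image_le[OF fin, of "image c"] by simp
  then show ?thesis by (rule eq_card_imp_inj_on[OF fin])
qed

text \<open>
  An arc inside a cell contributes nothing. Distinct arcs between distinct cells come from
  distinct edges outside \<open>F\<close> or from the two directions of one edge, so they yield distinct arcs of
  the contraction.
\<close>
lemma contraction_energy_le:
  assumes G: "simple_graph G" and match: "edge_matching G F (contract G p C)"
    and c: "c ` verts G = {1..p}"
    and C: "\<And>u i. u \<in> verts G \<Longrightarrow> i \<in> {1..p} \<Longrightarrow> u \<in> C i \<longleftrightarrow> c u = i"
    and sub: "\<And>i. i \<in> {1..p} \<Longrightarrow> C i \<subseteq> verts G"
    and F: "\<And>u v. u \<in> verts G \<Longrightarrow> v \<in> verts G \<Longrightarrow> {u, v} \<in> F \<Longrightarrow> c u = c v"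
  shows "dirichlet_energy G (\<lambda>u. g (c u)) \<le> dirichlet_energy (contract G p C) g"
proof -
  let ?H = "contract G p C"
  define X where "X = {(u, v) \<in> arcs G. c u \<noteq> c v}"
  have inj: "inj_on (map_prod c c) X"
  proof (rule inj_onI, clarify)
    fix u v u' v' assume uv: "(u, v) \<in> X" and uv': "(u', v') \<in> X"
      and eq: "map_prod c c (u, v) = map_prod c c (u', v')"
    then have "c u = c u'" "c v = c v'" by auto
    moreover have "{u, v} \<in> edges G - F" "{u', v'} \<in> edges G - F"
      using uv uv' F by (auto simp: X_def arcs_def adjacent_def)
    \<comment> \<open>Equal edges still allow a swap of the end points, which the distinct cells rule out.\<close>
    ultimately have "{u, v} = {u', v'}"
      using edge_matching_inj_on_edges[OF assms] by (auto simp: inj_on_def)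
    then show "u = u' \<and> v = v'"
      using uv \<open>c u = c u'\<close> \<open>c v = c v'\<close> by (auto simp: doubleton_eq_iff X_def)
  qed
  have img: "map_prod c c ` X \<subseteq> arcs ?H"
  proof
    fix x assume "x \<in> map_prod c c ` X"
    then obtain u v where x: "x = (c u, c v)" and uv: "(u, v) \<in> X" by auto
    have V: "u \<in> verts G" "v \<in> verts G" "adjacent G u v" "c u \<noteq> c v"
      using uv by (auto simp: X_def arcs_def)
    then have "c u \<in> {1..p}" "c v \<in> {1..p}" using c by blast+
    then show "x \<in> arcs ?H" using V C x by (auto simp: arcs_def contract_simps)
  qed
  have "(\<Sum>(u, v)\<in>arcs G. (g (c u) - g (c v))\<^sup>2) = (\<Sum>(u, v)\<in>X. (g (c u) - g (c v))\<^sup>2)"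
    using finite_arcs[OF G] by (intro sum.mono_neutral_right) (auto simp: X_def)
  also have "\<dots> = (\<Sum>(i, j)\<in>map_prod c c ` X. (g i - g j)\<^sup>2)"
    by (subst sum.reindex[OF inj]) (auto intro!: sum.cong)
  also have "\<dots> \<le> (\<Sum>(i, j)\<in>arcs ?H. (g i - g j)\<^sup>2)"
    by (intro sum_mono2 finite_arcs simple_graph_contract img) auto
  finally show ?thesis by (simp add: dirichlet_energy_def)
qed

theorem theorem5:
  fixes G :: "'a ugraph" and n r p :: nat and Ecs :: "'a set set"
    and \<nu> :: "nat \<Rightarrow> 'a" and C :: "nat \<Rightarrow> 'a set"
  assumes "simple_graph G" and "connected_graph G" and "card (verts G) = n"
    and "1 \<le> r" and "r < n"
    and "Ecs \<subseteq> edges G" and "card Ecs = n - r"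
    and "bij_betw \<nu> {0..<n} (verts G)"
    and "bij_betw C {1..p} (contraction_partition G Ecs)"
    and "edge_matching G Ecs (contract G p C)"
    and "node_removal_equivalent G (contract G p C)"
  shows "interlaces (laplacian Suc (contract G p C)) (laplacian \<nu> G)"
proof -
  let ?H = "contract G p C"
  obtain c where c: "c ` verts G = {1..p}"
    "\<And>u i. u \<in> verts G \<Longrightarrow> i \<in> {1..p} \<Longrightarrow> u \<in> C i \<longleftrightarrow> c u = i"
    "\<And>i. i \<in> {1..p} \<Longrightarrow> C i \<subseteq> verts G"
    "\<And>u v. u \<in> verts G \<Longrightarrow> v \<in> verts G \<Longrightarrow> {u, v} \<in> Ecs \<Longrightarrow> c u = c v"
    using contraction_cell_map[OF assms(9)] by blast
  have fin: "finite (verts G)" using assms(1) by (simp add: simple_graph_def)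
  have "verts G \<noteq> {}" using assms(3,5) by auto
  then have p: "0 < p" using c(1) by auto
  have "Ecs \<noteq> {}" using assms(5,7) by auto
  then obtain e where "e \<in> Ecs" by blast
  moreover from this have "e \<subseteq> verts G" "card e = 2"
    using assms(1,6) by (auto simp: simple_graph_def)
  ultimately obtain u v where "u \<in> verts G" "v \<in> verts G" "u \<noteq> v" "c u = c v"
    using c(4) by (auto simp: card_2_iff)
  \<comment> \<open>Some edge is contracted, so a cell has two vertices and there are fewer cells than vertices.\<close>
  then have "\<not> inj_on c (verts G)" by (auto simp: inj_on_def)
  then have pn: "p < n"
    using c(1) card_image_le[OF fin, of c] eq_card_imp_inj_on[OF fin, of c] assms(3)
    by (metis card_atLeastAtMost diff_Suc_1 le_neq_implies_less One_nat_def)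
  have H: "simple_graph ?H" "verts ?H = {1..p}" by (rule simple_graph_contract contract_simps)+
  have "eigval k (laplacian \<nu> G) \<le> eigval k (laplacian Suc ?H)" if "k \<in> {1..p}" for k
    using that pn contraction_energy_le[OF assms(1,10) c]
    by (intro eigval_le_of_energy_decrease[OF assms(1,8) H _ _ _ c(1)]) auto
  moreover have "eigval k (laplacian Suc ?H) \<le> eigval (n - p + k) (laplacian \<nu> G)"
    if "k \<in> {1..p}" for k
    using that pn by (intro node_removal_eigval_le[OF assms(1,8) H _ _ _ assms(11)]) auto
  ultimately show ?thesis
    unfolding interlaces_def using p pn assms(3)
    by (intro exI[of _ n] exI[of _ p]) (auto intro!: real_symmetric_laplacian simp: contract_simps)
qed

end
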